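(* Let $G$ be a $T_0$ strongly topological gyrogroup with symmetric neighborhood base $\mathscr U$ at $0$, and let $H$ be an admissible $L$-subgyrogroup of $G$ generated from $\mathscr U$. Then the left coset space $G/H$ is submetrizable.
   Context: A gyrogroup is a nonempty set $G$ with a binary operation $\oplus$ such that: (G1) there is a unique identity element $0\in G$ with $0\oplus a=a=a\oplus 0$ for all $a\in G$; (G2) for each $x\in G$ there is a unique inverse $\ominus x\in G$ with $\ominus x\oplus x=0=x\oplus(\ominus x)$; (G3) for all $x,y\in G$ there is a bijective homomorphism $\mathrm{gyr}[x,y]$ of $(G,\oplus)$ onto itself such that $x\oplus(y\oplus z)=(x\oplus y)\oplus \mathrm{gyr}[x,y](z)$ for all $z\in G$; (G4) $\mathrm{gyr}[x\oplus y,y]=\mathrm{gyr}[x,y]$ for all $x,y\in G$. A topological gyrogroup is a gyrogroup $(G,\oplus)$ with a topology such that $\oplus:G\times G\to G$ is (jointly) continuous and $x\mapsto\ominus x$ is continuous. A strongly topological gyrogroup with symmetric neighborhood base $\mathscr U$ at $0$ is a topological gyrogroup $G$ together with a neighborhood base $\mathscr U$ of $0$, consisting of open symmetric sets ($\ominus U=U$), such that $\mathrm{gyr}[x,y](U)=U$ for every $U\in\mathscr U$ and all $x,y\in G$. A subgyrogroup of $G$ is a nonempty subset $H$ closed under $\oplus$ and $\ominus$. It is an $L$-subgyrogroup if $\mathrm{gyr}[a,h](H)=H$ for all $a\in G$, $h\in H$. A subgyrogroup $H$ is admissible if there is a sequence $\{U_n:n\in\mathbb N\}$ of open symmetric neighborhoods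 of $0$ with $U_{n+1}\oplus(U_{n+1}\oplus U_{n+1})\subset U_n$ for each $n\in\mathbb N$ and $H=\bigcap_{n\in\mathbb N}U_n$; it is (admissible and) generated from $\mathscr U$ if such a sequence can be chosen with $U_n\in\mathscr U$ for each $n$. For an $L$-subgyrogroup $H$, the left cosets $a\oplus H$ ($a\in G$) form a partition $G/H$ of $G$; the left coset space $G/H$ carries the quotient topology with respect to $\pi:G\to G/H$, $\pi(a)=a\oplus H$. A space $X$ is submetrizable if there is a continuous one-to-one mapping of $X$ onto a metrizable space. *)

theory Defs
  imports "HOL-Analysis.Analysis"
begin

section \<open>Gyrogroups\<close>

text \<open>The identity, the inverse and the gyrations are determined by the operation on the carrier,
  so keeping them as fields of the structure adds no data; their values outside the carrier are
  irrelevant.\<close>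

record 'a gyrogroup_data =
  gcarrier :: "'a set"
  gplus :: "'a \<Rightarrow> 'a \<Rightarrow> 'a"  (infixl \<open>\<oplus>\<index>\<close> 65)
  gzero :: 'a  (\<open>\<zero>\<index>\<close>)
  gneg :: "'a \<Rightarrow> 'a"  (\<open>\<ominus>\<index> _\<close> [81] 80)
  gyration :: "'a \<Rightarrow> 'a \<Rightarrow> 'a \<Rightarrow> 'a"  (\<open>gyr\<index>\<close>)

locale gyrogroup =
  fixes G (structure)
  assumes plus_closed: "\<lbrakk>x \<in> gcarrier G; y \<in> gcarrier G\<rbrakk> \<Longrightarrow> x \<oplus> y \<in> gcarrier G"
    and zero_closed: "\<zero> \<in> gcarrier G"
    and zero_left: "a \<in> gcarrier G \<Longrightarrow> \<zero> \<oplus> a = a"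
    and zero_right: "a \<in> gcarrier G \<Longrightarrow> a \<oplus> \<zero> = a"
    and zero_unique: "\<lbrakk>e \<in> gcarrier G; \<And>a. a \<in> gcarrier G \<Longrightarrow> e \<oplus> a = a \<and> a \<oplus> e = a\<rbrakk> \<Longrightarrow> e = \<zero>"
    and neg_closed: "x \<in> gcarrier G \<Longrightarrow> \<ominus> x \<in> gcarrier G"
    and neg_left: "x \<in> gcarrier G \<Longrightarrow> (\<ominus> x) \<oplus> x = \<zero>"
    and neg_right: "x \<in> gcarrier G \<Longrightarrow> x \<oplus> (\<ominus> x) = \<zero>"
    and neg_unique: "\<lbrakk>x \<in> gcarrier G; y \<in> gcarrier G; y \<oplus> x = \<zero>; x \<oplus> y = \<zero>\<rbrakk> \<Longrightarrow> y = \<ominus> x"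
    and gyr_bij: "\<lbrakk>x \<in> gcarrier G; y \<in> gcarrier G\<rbrakk> \<Longrightarrow> bij_betw (gyr x y) (gcarrier G) (gcarrier G)"
    and gyr_hom: "\<lbrakk>x \<in> gcarrier G; y \<in> gcarrier G; a \<in> gcarrier G; b \<in> gcarrier G\<rbrakk>
          \<Longrightarrow> gyr x y (a \<oplus> b) = gyr x y a \<oplus> gyr x y b"
    and gyr_assoc: "\<lbrakk>x \<in> gcarrier G; y \<in> gcarrier G; z \<in> gcarrier G\<rbrakk>
          \<Longrightarrow> x \<oplus> (y \<oplus> z) = (x \<oplus> y) \<oplus> gyr x y z"
    and gyr_loop: "\<lbrakk>x \<in> gcarrier G; y \<in> gcarrier G; z \<in> gcarrier G\<rbrakk>
          \<Longrightarrow> gyr (x \<oplus> y) y z = gyr x y z"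

locale topological_gyrogroup = gyrogroup G for G (structure) +
  fixes X :: "'a topology"
  assumes topspace_eq: "topspace X = gcarrier G"
    and continuous_plus: "continuous_map (prod_topology X X) X (\<lambda>(x, y). x \<oplus> y)"
    and continuous_neg: "continuous_map X X (\<lambda>x. \<ominus> x)"

locale strongly_topological_gyrogroup = topological_gyrogroup G X for G (structure) and X +
  fixes \<U> :: "'a set set"
  assumes base: "neighbourhood_base_at \<zero> (\<lambda>U. U \<in> \<U>) X"
    and base_open: "U \<in> \<U> \<Longrightarrow> openin X U"
    and base_zero: "U \<in> \<U> \<Longrightarrow> \<zero> \<in> U"
    and base_symmetric: "U \<in> \<U> \<Longrightarrow> gneg G ` U = U"
    and base_gyr: "\<lbrakk>U \<in> \<U>; x \<in> gcarrier G; y \<in> gcarrier G\<rbrakk> \<Longrightarrow> gyr x y ` U = U"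

definition gset_plus :: "('a, 'm) gyrogroup_data_scheme \<Rightarrow> 'a set \<Rightarrow> 'a set \<Rightarrow> 'a set" where
  "gset_plus G A B = {gplus G a b | a b. a \<in> A \<and> b \<in> B}"

definition subgyrogroup :: "('a, 'm) gyrogroup_data_scheme \<Rightarrow> 'a set \<Rightarrow> bool" where
  "subgyrogroup G H \<longleftrightarrow> H \<noteq> {} \<and> H \<subseteq> gcarrier G \<and>
     (\<forall>x\<in>H. \<forall>y\<in>H. gplus G x y \<in> H) \<and> (\<forall>x\<in>H. gneg G x \<in> H)"

definition L_subgyrogroup :: "('a, 'm) gyrogroup_data_scheme \<Rightarrow> 'a set \<Rightarrow> bool" where
  "L_subgyrogroup G H \<longleftrightarrow> subgyrogroup G H \<and> (\<forall>a\<in>gcarrier G. \<forall>h\<in>H. gyration G a h ` H = H)"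

definition admissible_sequence ::
    "('a, 'm) gyrogroup_data_scheme \<Rightarrow> 'a topology \<Rightarrow> 'a set \<Rightarrow> (nat \<Rightarrow> 'a set) \<Rightarrow> bool" where
  "admissible_sequence G X H U \<longleftrightarrow>
     (\<forall>n. openin X (U n) \<and> gzero G \<in> U n \<and> gneg G ` U n = U n) \<and>
     (\<forall>n. gset_plus G (U (Suc n)) (gset_plus G (U (Suc n)) (U (Suc n))) \<subseteq> U n) \<and>
     H = (\<Inter>n. U n)"

definition admissible_subgyrogroup ::
    "('a, 'm) gyrogroup_data_scheme \<Rightarrow> 'a topology \<Rightarrow> 'a set \<Rightarrow> bool" where
  "admissible_subgyrogroup G X H \<longleftrightarrow> subgyrogroup G H \<and> (\<exists>U. admissible_sequence G X H U)"

definition admissible_generated_from ::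
    "('a, 'm) gyrogroup_data_scheme \<Rightarrow> 'a topology \<Rightarrow> 'a set set \<Rightarrow> 'a set \<Rightarrow> bool" where
  "admissible_generated_from G X \<U> H \<longleftrightarrow>
     subgyrogroup G H \<and> (\<exists>U. admissible_sequence G X H U \<and> (\<forall>n. U n \<in> \<U>))"

lemma admissible_generated_from_imp_admissible:
  "admissible_generated_from G X \<U> H \<Longrightarrow> admissible_subgyrogroup G X H"
  by (auto simp: admissible_generated_from_def admissible_subgyrogroup_def)

section \<open>Quotient topologies and left coset spaces\<close>

definition quotient_topology :: "'a topology \<Rightarrow> ('a \<Rightarrow> 'b) \<Rightarrow> 'b topology" where
  "quotient_topology X p =
     topology (\<lambda>S. S \<subseteq> p ` topspace X \<and> openin X {x \<in> topspace X. p x \<in> S})"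

lemma openin_quotient_topology:
  "openin (quotient_topology X p) S \<longleftrightarrow>
     S \<subseteq> p ` topspace X \<and> openin X {x \<in> topspace X. p x \<in> S}"
proof -
  have "istopology (\<lambda>S. S \<subseteq> p ` topspace X \<and> openin X {x \<in> topspace X. p x \<in> S})"
    unfolding istopology_def
  proof (rule conjI; clarify)
    fix S T
    assume S: "S \<subseteq> p ` topspace X" "openin X {x \<in> topspace X. p x \<in> S}"
      and T: "T \<subseteq> p ` topspace X" "openin X {x \<in> topspace X. p x \<in> T}"
    have "{x \<in> topspace X. p x \<in> S \<inter> T} =
        {x \<in> topspace X. p x \<in> S} \<inter> {x \<in> topspace X. p x \<in> T}"
      by auto
    then show "S \<inter> T \<subseteq> p ` topspace X \<and> openin X {x \<in> topspace X. p x \<in> S \<inter> T}"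
      using S T by auto
  next
    fix \<K>
    assume K: "\<forall>K\<in>\<K>. K \<subseteq> p ` topspace X \<and> openin X {x \<in> topspace X. p x \<in> K}"
    have "{x \<in> topspace X. p x \<in> \<Union>\<K>} = (\<Union>K\<in>\<K>. {x \<in> topspace X. p x \<in> K})"
      by auto
    moreover have "openin X (\<Union>K\<in>\<K>. {x \<in> topspace X. p x \<in> K})"
      using K by blast
    ultimately show "\<Union>\<K> \<subseteq> p ` topspace X \<and> openin X {x \<in> topspace X. p x \<in> \<Union>\<K>}"
      using K by auto
  qed
  then show ?thesis
    by (simp add: quotient_topology_def)
qed

lemma topspace_quotient_topology: "topspace (quotient_topology X p) = p ` topspace X"
proof
  have "{x \<in> topspace X. p x \<in> p ` topspace X} = topspace X" by auto
  then have "openin (quotient_topology X p) (p ` topspace X)"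
    by (simp add: openin_quotient_topology)
  then show "p ` topspace X \<subseteq> topspace (quotient_topology X p)"
    by (rule openin_subset)
  show "topspace (quotient_topology X p) \<subseteq> p ` topspace X"
    by (auto simp: topspace_def openin_quotient_topology)
qed

lemma quotient_map_quotient_topology: "quotient_map X (quotient_topology X p) p"
  by (auto simp: quotient_map_def topspace_quotient_topology openin_quotient_topology)

definition left_coset :: "('a, 'm) gyrogroup_data_scheme \<Rightarrow> 'a set \<Rightarrow> 'a \<Rightarrow> 'a set" where
  "left_coset G H a = gplus G a ` H"

definition left_coset_space ::
    "('a, 'm) gyrogroup_data_scheme \<Rightarrow> 'a topology \<Rightarrow> 'a set \<Rightarrow> 'a set topology" where
  "left_coset_space G X H = quotient_topology X (left_coset G H)"

section \<open>Submetrizable spaces\<close>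

text \<open>The metrizable space is sought on the type of points of the given space. This is no
  restriction, as the mapping is a bijection; see \<open>submetrizable_spaceI\<close>.\<close>

definition submetrizable_space :: "'a topology \<Rightarrow> bool" where
  "submetrizable_space X \<longleftrightarrow>
     (\<exists>(Y :: 'a topology) f. metrizable_space Y \<and> continuous_map X Y f \<and>
        inj_on f (topspace X) \<and> f ` topspace X = topspace Y)"

lemma submetrizable_spaceI:
  fixes X :: "'a topology" and Y :: "'b topology"
  assumes Y: "metrizable_space Y" and f: "continuous_map X Y f"
    and inj: "inj_on f (topspace X)" and onto: "f ` topspace X = topspace Y"
  shows "submetrizable_space X"
proof -
  define Z where "Z = pullback_topology (topspace X) f Y"
  have Z: "openin Z S \<longleftrightarrow> (\<exists>U. openin Y U \<and> S = f -` U \<inter> topspace X)" for S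
    by (simp add: Z_def openin_pullback_topology)
  have top: "topspace Z = topspace X"
    using onto by (auto simp: Z_def topspace_pullback_topology)
  have image: "f ` (f -` U \<inter> topspace X) = U" if "openin Y U" for U
    using openin_subset[OF that] unfolding onto[symmetric] by auto
  have cont: "continuous_map Z Y f"
    unfolding continuous_map
  proof (intro conjI allI impI)
    show "f ` topspace Z \<subseteq> topspace Y"
      by (simp add: top onto)
    fix U assume "openin Y U"
    then show "openin Z {x \<in> topspace Z. f x \<in> U}"
      unfolding Z top by blast
  qed
  have "open_map Z Y f"
    using image by (auto simp: open_map_def Z)
  with cont have "homeomorphic_map Z Y f"
    using inj onto by (simp add: bijective_open_imp_homeomorphic_map top)
  then have "metrizable_space Z"
    using Y homeomorphic_map_imp_homeomorphic_space homeomorphic_metrizable_space by blast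
  moreover have "continuous_map X Z id"
    unfolding continuous_map
  proof (intro conjI allI impI)
    show "id ` topspace X \<subseteq> topspace Z"
      by (simp add: top)
    fix S assume "openin Z S"
    then obtain U where U: "openin Y U" "S = f -` U \<inter> topspace X"
      using Z by blast
    then have "{x \<in> topspace X. id x \<in> S} = {x \<in> topspace X. f x \<in> U}"
      by auto
    then show "openin X {x \<in> topspace X. id x \<in> S}"
      using openin_continuous_map_preimage[OF f U(1)] by simp
  qed
  ultimately show ?thesis
    unfolding submetrizable_space_def using top by (intro exI[of _ Z] exI[of _ id]) auto
qed

end

theory Submission
  imports Defs
begin

text \<open>The relations \<open>\<ominus> x \<oplus> y \<in> U n\<close> are symmetric, because \<open>U n\<close> is symmetric and invariant
  under gyrations, and the composition of three copies of the \<open>(n + 1)\<close>-st one is contained in the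
  \<open>n\<close>-th one, by \<open>\<ominus> x \<oplus> z = (\<ominus> x \<oplus> y) \<oplus> gyr (\<ominus> x) y (\<ominus> y \<oplus> z)\<close>. The metrization lemma for
  countable uniformities turns them into a continuous pseudometric on \<open>G\<close>. Its zero set is the
  intersection of these relations, i.e. \<open>\<ominus> x \<oplus> y \<in> H\<close>, so it descends to a metric on \<open>G/H\<close>, which
  is continuous for the quotient topology.\<close>

section \<open>Pseudometrics from sequences of relations\<close>

text \<open>A path of \<open>k\<close> edges from \<open>x\<close> to \<open>y\<close> with total
  weight \<open>s\<close>. The edge count serves strong induction; the weight is exposed because the
  pseudometric is an infimum of weights.\<close>

inductive chain :: "('a \<Rightarrow> 'a \<Rightarrow> real) \<Rightarrow> nat \<Rightarrow> 'a \<Rightarrow> real \<Rightarrow> 'a \<Rightarrow> bool" for f where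
  chain_0: "chain f 0 x 0 x"
| chain_Suc: "chain f k x s y \<Longrightarrow> chain f (Suc k) x (s + f y z) z"

lemma chain_1: "chain f (Suc 0) x (f x y) y"
  using chain_Suc[OF chain_0] by simp

lemma chain_append:
  assumes "chain f l y t z" "chain f k x s y"
  shows "chain f (k + l) x (s + t) z"
  using assms
proof induction
  case (chain_Suc l y t z w)
  then show ?case
    using chain.chain_Suc[of f "k + l" x "s + t" z w] by (simp add: add.assoc)
qed simp

lemma chain_rev:
  assumes "chain f k x s y" and "\<And>x y. f x y = f y x"
  shows "chain f k y s x"
  using assms(1)
proof induction
  case (chain_Suc k x s y z)
  then show ?case
    using chain_append[OF _ chain_1, of f k y s x z] assms(2)[of y z] by (simp add: add.commute)
qed (rule chain_0)

lemma chain_nonneg: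
  assumes "chain f k x s y" and "\<And>x y. 0 \<le> f x y"
  shows "0 \<le> s"
  using assms(1) by induction (auto intro: add_nonneg_nonneg assms(2))

text \<open>The edge from \<open>u\<close> to \<open>v\<close> is the last one whose preceding part
  weighs at most \<open>t\<close>. Once it is added, the weight is at least \<open>t\<close>, so at
  most \<open>s - t\<close> remains.\<close>

lemma chain_split:
  assumes "chain f k x s z" "0 < k" "0 \<le> t" "t \<le> s"
  shows "\<exists>i j u v s1 s2. chain f i x s1 u \<and> chain f j v s2 z \<and> i < k \<and> j < k \<and>
           s = s1 + f u v + s2 \<and> s1 \<le> t \<and> s2 \<le> s - t"
  using assms
proof induction
  case (chain_Suc k x s y z)
  show ?case
  proof (cases "s \<le> t")
    case True
    then show ?thesis
      using chain_Suc.hyps chain_Suc.prems chain_0[of f z]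
      by (intro exI[of _ k] exI[of _ 0] exI[of _ y] exI[of _ z] exI[of _ s] exI[of _ "0::real"]) auto
  next
    case False
    then have "0 < k"
      using chain_Suc.hyps chain_Suc.prems by (cases k) (auto elim: chain.cases)
    then obtain i j u v s1 s2 where
      "chain f i x s1 u" "chain f j v s2 y" "i < k" "j < k"
      "s = s1 + f u v + s2" "s1 \<le> t" "s2 \<le> s - t"
      using chain_Suc.IH chain_Suc.prems False by fastforce
    then show ?thesis
      using chain.chain_Suc[of f j v s2 y z]
      by (intro exI[of _ i] exI[of _ "Suc j"] exI[of _ u] exI[of _ v] exI[of _ s1]
          exI[of _ "s2 + f y z"]) auto
  qed
qed simp

text \<open>Strong induction on the number of edges, with \<open>n\<close> arbitrary: the outer
  pieces have at most half the weight and so are handled at index \<open>Suc n\<close>, and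
  \<open>comp\<close> brings the three pieces back to \<open>n\<close>. The bound is thus
  independent of the length of the chain.\<close>

lemma chain_imp_related:
  fixes W :: "nat \<Rightarrow> 'a \<Rightarrow> 'a \<Rightarrow> bool"
  assumes W0: "\<And>x y. W 0 x y" and refl: "\<And>n x. W n x x"
    and comp: "\<And>n x y z w. W (Suc n) x y \<Longrightarrow> W (Suc n) y z \<Longrightarrow> W (Suc n) z w \<Longrightarrow> W n x w"
    and f0: "\<And>x y. 0 \<le> f x y" and fW: "\<And>n x y. f x y < (1/2)^n \<Longrightarrow> W (Suc n) x y"
    and "chain f k x s y" "s < (1/2)^n"
  shows "W n x y"
  using assms(6,7)
proof (induction k arbitrary: x s y n rule: less_induct)
  case (less k)
  show ?case
  proof (cases "k = 0")
    case True
    with less.prems refl show ?thesis by (auto elim: chain.cases)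
  next
    case False
    \<comment> \<open>Cutting the chain at the edge that crosses half of its weight leaves three pieces to compose.\<close>
    have s: "0 \<le> s" using chain_nonneg[OF less.prems(1) f0] .
    then obtain i j u v s1 s2 where
      c: "chain f i x s1 u" "chain f j v s2 y" "i < k" "j < k"
      "s = s1 + f u v + s2" "s1 \<le> s/2" "s2 \<le> s - s/2"
      using chain_split[OF less.prems(1), of "s/2"] False by fastforce
    have "W (Suc n) x u" "W (Suc n) v y"
      using less.IH[OF c(3,1), of "Suc n"] less.IH[OF c(4,2), of "Suc n"] c(6,7) less.prems(2)
      by auto
    \<comment> \<open>The middle edge need not be light compared with \<open>s\<close>; the bound
      \<open>(1/2)^n\<close> suffices because \<open>fW\<close> gains one index.\<close>
    moreover have "f u v < (1/2)^n"
      using chain_nonneg[OF c(1) f0] chain_nonneg[OF c(2) f0] c(5) less.prems(2) by simp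
    ultimately show ?thesis using comp fW by blast
  qed
qed

text \<open>The edge weight \<open>f\<close> may violate the triangle inequality. The infimum
  \<open>d\<close> of chain weights repairs this, and \<open>chain_imp_related\<close> keeps
  \<open>d\<close> from becoming too small to detect \<open>V\<close>.\<close>

lemma pseudometric_of_relations:
  fixes V :: "nat \<Rightarrow> 'a \<Rightarrow> 'a \<Rightarrow> bool"
  assumes refl: "\<And>n x. V n x x" and sym: "\<And>n x y. V n x y \<Longrightarrow> V n y x"
    and comp: "\<And>n x y z w. V (Suc n) x y \<Longrightarrow> V (Suc n) y z \<Longrightarrow> V (Suc n) z w \<Longrightarrow> V n x w"
  obtains d :: "'a \<Rightarrow> 'a \<Rightarrow> real"
  where "\<And>x y. 0 \<le> d x y" "\<And>x y. d x y = d y x" "\<And>x y z. d x z \<le> d x y + d y z"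
    "\<And>n x y. V n x y \<Longrightarrow> d x y \<le> (1/2)^n"
    "\<And>n x y. d x y < (1/2)^Suc n \<Longrightarrow> V n x y"
proof -
  \<comment> \<open>Starting with the full relation makes the set of which \<open>f\<close> is the infimum nonempty.\<close>
  define W where "W n x y \<longleftrightarrow> (case n of 0 \<Rightarrow> True | Suc m \<Rightarrow> V m x y)" for n x y
  define f :: "'a \<Rightarrow> 'a \<Rightarrow> real" where "f x y = Inf {(1/2)^n | n. W n x y}" for x y
  define d where "d x y = Inf {s. \<exists>k. chain f k x s y}" for x y
  have W0: "W 0 x y" for x y by (simp add: W_def)
  have Wrefl: "W n x x" for n x by (simp add: W_def refl split: nat.split)
  have Wsym: "W n x y \<longleftrightarrow> W n y x" for n x y by (auto simp: W_def sym split: nat.split)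
  have Wcomp: "W n x w" if "W (Suc n) x y" "W (Suc n) y z" "W (Suc n) z w" for n x y z w
    using that comp by (cases n) (auto simp: W_def)
  \<comment> \<open>Padding \<open>Wcomp\<close> with trivial steps from \<open>Wrefl\<close> shows
    that each relation contains the next.\<close>
  have Wanti: "W n x y" if "W m x y" "n \<le> m" for m n x y
    using that(2,1) by (induction rule: inc_induct) (use Wcomp Wrefl in blast)+
  have bdd: "bdd_below {(1/2)^n :: real | n. W n x y}" for x y
    by (rule bdd_belowI[of _ "0::real"]) auto
  have f0: "0 \<le> f x y" for x y
    unfolding f_def using W0 by (intro cInf_greatest) auto
  have f_le: "f x y \<le> (1/2)^n" if "W n x y" for n x y
    unfolding f_def using that bdd by (intro cInf_lower) auto
  have fW: "W (Suc n) x y" if less: "f x y < (1/2)^n" for n x y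
  proof -
    have "{(1/2)^n :: real | n. W n x y} \<noteq> {}" using W0 by blast
    from cInf_lessD[OF this less[unfolded f_def]]
    obtain m where m: "W m x y" "(1/2)^m < ((1/2)^n :: real)" by blast
    \<comment> \<open>The infimum is undercut by an actual power, whose index is at least
      \<open>Suc n\<close>: this is the gained index.\<close>
    have "n < m"
      using m(2) power_decreasing[of m n "1/2::real"] by (force simp: not_less)
    then show ?thesis using Wanti m(1) by simp
  qed
  have fsym: "f x y = f y x" for x y unfolding f_def using Wsym[of _ x y] by simp
  have chain0: "0 \<le> s" if "chain f k x s y" for k x s y
    using chain_nonneg[OF that f0] .
  have bdd': "bdd_below {s. \<exists>k. chain f k x s y}" for x y
    by (rule bdd_belowI[of _ 0]) (use chain0 in blast)
  have ne: "{s. \<exists>k. chain f k x s y} \<noteq> {}" for x y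
    using chain_1 by fast
  have d_le: "d x y \<le> s" if "chain f k x s y" for k x s y
    unfolding d_def using that bdd' by (intro cInf_lower) auto
  have d_less: "\<exists>k s. chain f k x s y \<and> s < e" if "d x y < e" for x y e
    using cInf_lessD[OF ne that[unfolded d_def]] by auto
  show thesis
  proof
    show "0 \<le> d x y" for x y
      unfolding d_def using ne by (intro cInf_greatest) (use chain0 in blast)+
    show "d x y = d y x" for x y
      unfolding d_def using chain_rev[of f] fsym by (intro arg_cong[where f = Inf]) blast
    show "d x z \<le> d x y + d y z" for x y z
    \<comment> \<open>Two chains within \<open>e/2\<close> of their infima are concatenated.\<close>
    proof (rule field_le_epsilon)
      fix e :: real assume "0 < e"
      then obtain k s l t where "chain f k x s y" "s < d x y + e/2"
        "chain f l y t z" "t < d y z + e/2"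
        using d_less[of x y "d x y + e/2"] d_less[of y z "d y z + e/2"] by auto
      then show "d x z \<le> d x y + d y z + e"
        using d_le[OF chain_append, of l y t z k x s] by simp
    qed
    show "d x y \<le> (1/2)^n" if "V n x y" for n x y
    proof -
      \<comment> \<open>Since \<open>V n\<close> is \<open>W (Suc n)\<close>, a single edge already
        gives half of the required bound. The same shift accounts for \<open>Suc n\<close> in the
        last property.\<close>
      have "d x y \<le> (1/2)^Suc n"
        using order_trans[OF d_le[OF chain_1] f_le[of "Suc n"]] that by (simp add: W_def)
      also have "\<dots> \<le> (1/2)^n" by simp
      finally show ?thesis .
    qed
    show "V n x y" if less: "d x y < (1/2)^Suc n" for n x y
    proof -
      obtain k s where c: "chain f k x s y" "s < (1/2)^Suc n" using d_less[OF less] by blast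
      have "W (Suc n) x y"
        by (rule chain_imp_related[of W f]) (fact W0 Wrefl Wcomp f0 fW c)+
      then show ?thesis by (simp add: W_def)
    qed
  qed
qed

section \<open>Cancellation in gyrogroups\<close>

context gyrogroup
begin

lemma gyr_closed:
  "\<lbrakk>x \<in> gcarrier G; y \<in> gcarrier G; z \<in> gcarrier G\<rbrakk> \<Longrightarrow> gyr x y z \<in> gcarrier G"
  using gyr_bij bij_betwE by blast

lemma gyr_inject:
  "\<lbrakk>x \<in> gcarrier G; y \<in> gcarrier G; a \<in> gcarrier G; b \<in> gcarrier G; gyr x y a = gyr x y b\<rbrakk>
    \<Longrightarrow> a = b"
  using gyr_bij by (meson bij_betw_imp_inj_on inj_onD)

text \<open>Adding \<open>\<ominus> x\<close> on the left turns both sides into values of the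
  injective map \<open>gyr (\<ominus> x) x\<close>. That this gyration is the identity comes only
  later, by way of this lemma.\<close>

lemma plus_left_imp_eq:
  assumes "x \<in> gcarrier G" "a \<in> gcarrier G" "b \<in> gcarrier G" "x \<oplus> a = x \<oplus> b"
  shows "a = b"
proof -
  have "\<ominus> x \<oplus> (x \<oplus> c) = gyr (\<ominus> x) x c" if "c \<in> gcarrier G" for c
    using that assms(1) by (simp add: gyr_assoc neg_closed neg_left zero_left gyr_closed)
  then show ?thesis
    using assms gyr_inject[of "\<ominus> x" x a b] neg_closed by metis
qed

lemma gyr_zero_left:
  assumes "a \<in> gcarrier G" "z \<in> gcarrier G"
  shows "gyr \<zero> a z = z"
proof -
  have "a \<oplus> z = a \<oplus> gyr \<zero> a z"
    using assms gyr_assoc[of \<zero> a z] by (simp add: zero_closed zero_left plus_closed)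
  then show ?thesis
    using assms plus_left_imp_eq gyr_closed zero_closed by metis
qed

lemma neg_plus_cancel:
  assumes "x \<in> gcarrier G" "y \<in> gcarrier G"
  shows "\<ominus> x \<oplus> (x \<oplus> y) = y"
proof -
  \<comment> \<open>The loop property identifies \<open>gyr (\<ominus> x) x\<close> with
    \<open>gyr \<zero> x\<close>, which is trivial.\<close>
  have "gyr (\<ominus> x) x y = y"
    using assms gyr_loop[of "\<ominus> x" x y] by (simp add: neg_closed neg_left gyr_zero_left)
  then show ?thesis
    using assms by (simp add: gyr_assoc neg_closed neg_left zero_left)
qed

lemma neg_neg: "x \<in> gcarrier G \<Longrightarrow> \<ominus> (\<ominus> x) = x"
  using neg_unique[of "\<ominus> x" x] by (simp add: neg_closed neg_left neg_right)

lemma plus_neg_cancel: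
  assumes "x \<in> gcarrier G" "y \<in> gcarrier G"
  shows "x \<oplus> (\<ominus> x \<oplus> y) = y"
  using neg_plus_cancel[of "\<ominus> x" y] assms by (simp add: neg_closed neg_neg)

lemma neg_plus_via:
  assumes "x \<in> gcarrier G" "y \<in> gcarrier G" "z \<in> gcarrier G"
  shows "(\<ominus> x \<oplus> y) \<oplus> gyr (\<ominus> x) y (\<ominus> y \<oplus> z) = \<ominus> x \<oplus> z"
  using gyr_assoc[of "\<ominus> x" y "\<ominus> y \<oplus> z"] assms
  by (simp add: neg_closed plus_closed plus_neg_cancel)

text \<open>By \<open>neg_plus_via\<close> with \<open>z = x\<close>, the gyration carries
  \<open>\<ominus> y \<oplus> x\<close> to the inverse of \<open>\<ominus> x \<oplus> y\<close>.
  Symmetry puts that inverse into \<open>A\<close>; invariance and injectivity pull membership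
  back.\<close>

lemma neg_plus_mem_commute:
  assumes "x \<in> gcarrier G" "y \<in> gcarrier G"
    and "A \<subseteq> gcarrier G" "gneg G ` A = A" "gyr (\<ominus> x) y ` A = A"
    and "\<ominus> x \<oplus> y \<in> A"
  shows "\<ominus> y \<oplus> x \<in> A"
proof -
  define a where "a = \<ominus> x \<oplus> y"
  define c where "c = \<ominus> y \<oplus> x"
  have ac: "a \<in> gcarrier G" "c \<in> gcarrier G" "gyr (\<ominus> x) y c \<in> gcarrier G"
    using assms(1,2) by (auto simp: a_def c_def plus_closed neg_closed gyr_closed)
  have "a \<oplus> gyr (\<ominus> x) y c = \<zero>"
    using neg_plus_via[of x y x] assms(1,2) by (simp add: a_def c_def neg_left)
  then have "gyr (\<ominus> x) y c = \<ominus> a"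
    using neg_plus_cancel[OF ac(1,3)] by (simp add: zero_right neg_closed ac)
  then have "gyr (\<ominus> x) y c \<in> gyr (\<ominus> x) y ` A"
    using assms(4-6) by (metis a_def imageI)
  then obtain b where "b \<in> A" "gyr (\<ominus> x) y c = gyr (\<ominus> x) y b" by blast
  then show ?thesis
    using gyr_inject[of "\<ominus> x" y c b] ac assms(1-3) neg_closed by (auto simp: c_def)
qed

text \<open>Two uses of \<open>neg_plus_via\<close>. Distributing the outer gyration over the inner
  sum yields the right-nested bracketing, and invariance keeps every summand in
  \<open>A\<close>.\<close>

lemma neg_plus_mem_compose:
  assumes "x \<in> gcarrier G" "y \<in> gcarrier G" "z \<in> gcarrier G" "w \<in> gcarrier G"
    and "A \<subseteq> gcarrier G"
    and "\<ominus> x \<oplus> y \<in> A" "\<ominus> y \<oplus> z \<in> A" "\<ominus> z \<oplus> w \<in> A"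
    and inv: "\<And>a b. \<lbrakk>a \<in> gcarrier G; b \<in> gcarrier G\<rbrakk> \<Longrightarrow> gyr a b ` A = A"
  shows "\<ominus> x \<oplus> w \<in> gset_plus G A (gset_plus G A A)"
proof -
  have gyr_mem: "gyr a b c \<in> A" if "a \<in> gcarrier G" "b \<in> gcarrier G" "c \<in> A" for a b c
    using inv that by blast
  define e where "e = gyr (\<ominus> y) z (\<ominus> z \<oplus> w)"
  have e: "e \<in> A" "\<ominus> y \<oplus> w = (\<ominus> y \<oplus> z) \<oplus> e"
    using assms neg_plus_via[of y z w] by (simp_all add: e_def gyr_mem neg_closed)
  have "\<ominus> x \<oplus> w = (\<ominus> x \<oplus> y) \<oplus> (gyr (\<ominus> x) y (\<ominus> y \<oplus> z) \<oplus> gyr (\<ominus> x) y e)"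
    using neg_plus_via[of x y w] gyr_hom[of "\<ominus> x" y "\<ominus> y \<oplus> z" e] assms(1-5) e
    by (simp add: neg_closed plus_closed subsetD)
  moreover have "gyr (\<ominus> x) y (\<ominus> y \<oplus> z) \<in> A" "gyr (\<ominus> x) y e \<in> A"
    using gyr_mem[OF neg_closed] assms(1,2,7) e(1) by simp_all
  ultimately show ?thesis
    using assms(6) unfolding gset_plus_def by blast
qed

lemma left_coset_eq_iff:
  assumes H: "L_subgyrogroup G H" and xy: "x \<in> gcarrier G" "y \<in> gcarrier G"
    and commute: "\<ominus> x \<oplus> y \<in> H \<Longrightarrow> \<ominus> y \<oplus> x \<in> H"
  shows "left_coset G H x = left_coset G H y \<longleftrightarrow> \<ominus> x \<oplus> y \<in> H"
proof
  have HG: "H \<subseteq> gcarrier G" and Hne: "H \<noteq> {}"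
    and Hplus: "\<And>a b. \<lbrakk>a \<in> H; b \<in> H\<rbrakk> \<Longrightarrow> a \<oplus> b \<in> H"
    and Hneg: "\<And>a. a \<in> H \<Longrightarrow> \<ominus> a \<in> H"
    and Hgyr: "\<And>a h. \<lbrakk>a \<in> gcarrier G; h \<in> H\<rbrakk> \<Longrightarrow> gyr a h ` H = H"
    using H by (auto simp: L_subgyrogroup_def subgyrogroup_def)
  have "\<zero> \<in> H" using HG Hne Hplus Hneg neg_left by (metis all_not_in_conv subsetD)
  show "\<ominus> x \<oplus> y \<in> H" if eq: "left_coset G H x = left_coset G H y"
  proof -
    have "y \<in> left_coset G H y"
      using xy(2) \<open>\<zero> \<in> H\<close> zero_right[of y] by (force simp: left_coset_def)
    then have "y \<in> left_coset G H x" by (simp only: eq)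
    then obtain h where "h \<in> H" "y = x \<oplus> h" by (auto simp: left_coset_def)
    then show ?thesis using neg_plus_cancel xy HG by auto
  qed
  have sub: "left_coset G H b \<subseteq> left_coset G H a"
    if ab: "a \<in> gcarrier G" "b \<in> gcarrier G" and mem: "\<ominus> a \<oplus> b \<in> H" for a b
  proof
    fix c assume "c \<in> left_coset G H b"
    then obtain k where k: "k \<in> H" "c = b \<oplus> k" by (auto simp: left_coset_def)
    define h where "h = \<ominus> a \<oplus> b"
    have h: "h \<in> H" "b = a \<oplus> h"
      using ab mem by (simp_all add: h_def plus_neg_cancel)
    \<comment> \<open>The L-property makes \<open>k\<close> a value of \<open>gyr a h\<close> on
      \<open>H\<close>, so gyroassociativity can be read from right to left.\<close>
    obtain k' where k': "k' \<in> H" "k = gyr a h k'" using Hgyr[OF ab(1) h(1)] k(1) by blast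
    then have "c = a \<oplus> (h \<oplus> k')"
      using gyr_assoc[of a h k'] ab(1) h k(2) HG by (metis subsetD)
    then show "c \<in> left_coset G H a"
      using Hplus h(1) k'(1) by (auto simp: left_coset_def)
  qed
  show "left_coset G H x = left_coset G H y" if "\<ominus> x \<oplus> y \<in> H"
    using sub[of x y] sub[of y x] xy that commute by blast
qed

end

lemma (in topological_gyrogroup) openin_left_translate:
  assumes "a \<in> gcarrier G" "openin X U"
  shows "openin X {y \<in> gcarrier G. a \<oplus> y \<in> U}"
proof -
  have "continuous_map X (prod_topology X X) (\<lambda>y. (a, y))"
    using assms(1) by (simp add: continuous_map_pairwise o_def topspace_eq)
  then have "continuous_map X X (\<lambda>y. a \<oplus> y)"
    using continuous_map_compose[OF _ continuous_plus] by (fastforce simp: o_def)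
  from openin_continuous_map_preimage[OF this assms(2)] show ?thesis
    by (simp add: topspace_eq)
qed

section \<open>Submetrizable quotients\<close>

text \<open>Points of one fibre of \<open>p\<close> have distance zero, so evaluating
  \<open>d\<close> at chosen representatives gives a metric on the image of \<open>p\<close>. Its
  topology may be coarser than the quotient topology.\<close>

lemma submetrizable_quotient_topology:
  fixes d :: "'a \<Rightarrow> 'a \<Rightarrow> real"
  assumes d_nonneg: "\<And>x y. 0 \<le> d x y" and d_sym: "\<And>x y. d x y = d y x"
    and d_triangle: "\<And>x y z. d x z \<le> d x y + d y z"
    and d_zero: "\<And>x y. \<lbrakk>x \<in> topspace X; y \<in> topspace X\<rbrakk> \<Longrightarrow> d x y = 0 \<longleftrightarrow> p x = p y"
    and cont: "\<And>x e. \<lbrakk>x \<in> topspace X; 0 < e\<rbrakk> \<Longrightarrow>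
        \<exists>U. openin X U \<and> x \<in> U \<and> (\<forall>y\<in>U. d x y < e)"
  shows "submetrizable_space (quotient_topology X p)"
proof -
  define M where "M = p ` topspace X"
  define r where "r = inv_into (topspace X) p"
  have r: "r A \<in> topspace X" "p (r A) = A" if "A \<in> M" for A
    using that unfolding M_def r_def by (auto intro: inv_into_into f_inv_into_f)
  define D where "D A B = d (r A) (r B)" for A B
  interpret Metric_space M D
  proof
    show "D A B = 0 \<longleftrightarrow> A = B" if "A \<in> M" "B \<in> M" for A B
      using d_zero[of "r A" "r B"] r[OF that(1)] r[OF that(2)] by (simp add: D_def)
  qed (unfold D_def, (rule d_nonneg d_sym d_triangle)+)
  \<comment> \<open>Passing from a point to the representative of its fibre costs distance
    zero.\<close>
  have D_le: "D (p x) (p y) \<le> d x y" if "x \<in> topspace X" "y \<in> topspace X" for x y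
  proof -
    have "p x \<in> M" "p y \<in> M" using that by (auto simp: M_def)
    then have "d (r (p x)) x = 0" "d y (r (p y)) = 0"
      using d_zero[of "r (p x)" x] d_zero[of y "r (p y)"] r that by auto
    then show ?thesis
      using d_triangle[of "r (p x)" "r (p y)" x] d_triangle[of x "r (p y)" y] by (simp add: D_def)
  qed
  have "continuous_map X mtopology p"
    unfolding continuous_map_to_metric
  proof (intro ballI allI impI)
    fix x and e :: real assume x: "x \<in> topspace X" and "0 < e"
    then obtain U where U: "openin X U" "x \<in> U" "\<forall>y\<in>U. d x y < e" using cont by blast
    have "p y \<in> mball (p x) e" if "y \<in> U" for y
    proof -
      have y: "y \<in> topspace X" using that openin_subset[OF U(1)] by blast
      have "D (p x) (p y) < e" using D_le[OF x y] U(3) that by fastforce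
      moreover have "p x \<in> M" "p y \<in> M" using x y by (simp_all add: M_def)
      ultimately show ?thesis by simp
    qed
    then show "\<exists>U. openin X U \<and> x \<in> U \<and> (\<forall>y\<in>U. p y \<in> mball (p x) e)"
      using U by blast
  qed
  \<comment> \<open>By the universal property of the quotient, continuity of \<open>p\<close>
    descends to the identity, which is the required one-to-one map.\<close>
  then have "continuous_map (quotient_topology X p) mtopology id"
    by (intro continuous_compose_quotient_map[OF quotient_map_quotient_topology]) simp
  then show ?thesis
    by (rule submetrizable_spaceI[OF metrizable_space_mtopology])
      (simp_all add: topspace_quotient_topology M_def[symmetric])
qed

theorem theorem4p8:
  fixes G :: "('a, 'm) gyrogroup_data_scheme"
    and X :: "'a topology" and \<U> :: "'a set set" and H :: "'a set"
  assumes "strongly_topological_gyrogroup G X \<U>"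
    and "t0_space X"
    and "L_subgyrogroup G H"
    and "admissible_generated_from G X \<U> H"
  shows "submetrizable_space (left_coset_space G X H)"
proof -
  interpret strongly_topological_gyrogroup G X \<U> by fact
  obtain U where adm: "admissible_sequence G X H U" and U\<U>: "\<And>n. U n \<in> \<U>"
    using assms(4) by (auto simp: admissible_generated_from_def)
  have U_comp: "gset_plus G (U (Suc n)) (gset_plus G (U (Suc n)) (U (Suc n))) \<subseteq> U n" for n
    using adm unfolding admissible_sequence_def by blast
  have H_eq: "H = (\<Inter>n. U n)"
    using adm unfolding admissible_sequence_def by blast
  note U_props = base_open[OF U\<U>] base_zero[OF U\<U>] base_symmetric[OF U\<U>] base_gyr[OF U\<U>]
  have U_sub: "U n \<subseteq> gcarrier G" for n
    using openin_subset[OF U_props(1)] topspace_eq by blast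
  \<comment> \<open>The disjunct \<open>x = y\<close> makes the relations reflexive outside the carrier as well.\<close>
  define V where "V n x y \<longleftrightarrow> x = y \<or> x \<in> gcarrier G \<and> y \<in> gcarrier G \<and> gplus G (gneg G x) y \<in> U n"
    for n x y
  \<comment> \<open>On the carrier the diagonal is already covered, as \<open>\<zero>\<close> lies
    in every \<open>U n\<close>.\<close>
  have V_iff: "V n x y \<longleftrightarrow> gplus G (gneg G x) y \<in> U n" if "x \<in> gcarrier G" "y \<in> gcarrier G" for n x y
    using that U_props(2) by (auto simp: V_def neg_left)
  have commute: "gplus G (gneg G y) x \<in> U n"
    if "x \<in> gcarrier G" "y \<in> gcarrier G" "gplus G (gneg G x) y \<in> U n" for n x y
    using neg_plus_mem_commute[OF that(1,2) U_sub U_props(3)] that U_props(4) neg_closed by blast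
  have V_refl: "V n x x" for n x by (simp add: V_def)
  have V_sym: "V n y x" if "V n x y" for n x y
    using that commute unfolding V_def by blast
  have V_comp: "V n x w" if V: "V (Suc n) x y" "V (Suc n) y z" "V (Suc n) z w" for n x y z w
  proof (cases "x \<in> gcarrier G")
    case True
    then have G: "y \<in> gcarrier G" "z \<in> gcarrier G" "w \<in> gcarrier G" using V by (auto simp: V_def)
    have "gplus G (gneg G x) w \<in> gset_plus G (U (Suc n)) (gset_plus G (U (Suc n)) (U (Suc n)))"
      using V unfolding V_iff[OF True G(1)] V_iff[OF G(1,2)] V_iff[OF G(2,3)]
      by (rule neg_plus_mem_compose[OF True G U_sub]) (rule U_props(4))
    then show ?thesis using V_iff[OF True G(3)] U_comp by blast
  next
    case False
    then show ?thesis using V by (auto simp: V_def)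
  qed
  show ?thesis
  proof (rule pseudometric_of_relations[of V])
    fix d :: "'a \<Rightarrow> 'a \<Rightarrow> real"
    assume d: "\<And>x y. 0 \<le> d x y" "\<And>x y. d x y = d y x" "\<And>x y z. d x z \<le> d x y + d y z"
      "\<And>n x y. V n x y \<Longrightarrow> d x y \<le> (1/2)^n"
      "\<And>n x y. d x y < (1/2)^Suc n \<Longrightarrow> V n x y"
    have small: "\<exists>n. (1/2)^n < e" if "0 < e" for e :: real
      using real_arch_pow_inv[OF that, of "1/2"] by simp
    show ?thesis
      unfolding left_coset_space_def
    proof (rule submetrizable_quotient_topology[OF d(1-3)], unfold topspace_eq)
      fix x y assume xy: "x \<in> gcarrier G" "y \<in> gcarrier G"
      \<comment> \<open>Smallness of \<open>d\<close> forces every \<open>V n\<close>; conversely,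
        the bounds \<open>(1/2)^n\<close> tend to zero.\<close>
      have "d x y = 0 \<longleftrightarrow> (\<forall>n. V n x y)"
      proof
        show "\<forall>n. V n x y" if "d x y = 0" using that d(5) by simp
        show "d x y = 0" if V: "\<forall>n. V n x y"
        proof (rule ccontr)
          assume "d x y \<noteq> 0"
          then obtain n where "(1/2)^n < d x y" using small[of "d x y"] d(1)[of x y] by auto
          with V d(4)[of n x y] show False by simp
        qed
      qed
      also have "\<dots> \<longleftrightarrow> gplus G (gneg G x) y \<in> H"
        using V_iff[OF xy] by (simp add: H_eq)
      also have "\<dots> \<longleftrightarrow> left_coset G H x = left_coset G H y"
      proof (rule left_coset_eq_iff[OF assms(3) xy, symmetric])
        \<comment> \<open>Symmetry holds at each level \<open>U n\<close> and so passes to the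
          intersection.\<close>
        show "gplus G (gneg G y) x \<in> H" if "gplus G (gneg G x) y \<in> H"
          using that commute[OF xy] by (simp add: H_eq)
      qed
      finally show "d x y = 0 \<longleftrightarrow> left_coset G H x = left_coset G H y" .
    next
      fix x and e :: real assume x: "x \<in> gcarrier G" and "0 < e"
      then obtain n where n: "(1/2)^n < e" using small by blast
      \<comment> \<open>The preimage of \<open>U n\<close> under left translation by the inverse of
        \<open>x\<close> is the set of carrier points related to \<open>x\<close> by
        \<open>V n\<close>.\<close>
      let ?N = "{y \<in> gcarrier G. gplus G (gneg G x) y \<in> U n}"
      have "openin X ?N" using openin_left_translate[OF neg_closed[OF x] U_props(1)] .
      moreover have "x \<in> ?N" using x neg_left U_props(2) by simp
      moreover have "d x y < e" if "y \<in> ?N" for y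
      proof -
        have "V n x y" using that by (simp add: V_iff x)
        then show ?thesis using d(4)[of n x y] n by linarith
      qed
      ultimately show "\<exists>N. openin X N \<and> x \<in> N \<and> (\<forall>y\<in>N. d x y < e)" by blast
    qed
  qed (fact V_refl V_sym V_comp)+
qed

end
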